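(* The PD-based proper decomposition is an interaction decomposition. That is, with $\mathcal{L}_{J,\mathrm{PD}}:=\mathbb{E}_{\mathbf{X}_{\setminus J}}$ for $\emptyset\neq J\subseteq D$, the family of linear operators $\{\mathcal{H}_{J,\mathrm{PD}}:V_D\to V_J\}_{J\subseteq D}$ defined recursively by $$\mathcal{H}_{\emptyset,\mathrm{PD}}:=\mathbb{E},\qquad \mathcal{H}_{J,\mathrm{PD}}:=\Big(I-\sum_{J'\subsetneq J}\mathcal{H}_{J',\mathrm{PD}}\Big)\circ\mathcal{L}_{J,\mathrm{PD}}\quad(J\neq\emptyset)$$ is an interaction decomposition.
   Context: Setting. Let $d\ge 1$, $D=\{1,\dots,d\}$, and let $\mathbf{X}_D=(X_1,\dots,X_d)$ be a random vector of real feature variables (possibly dependent), each $X_j$ having compactly supported distribution. Let $\mathcal{X}_j\subset\mathbb{R}$ be the nonempty compact set of values that the variable $x_j$ can take, with $X_j\in\mathcal{X}_j$. $V_D$ is the real vector space of bounded measurable functions $g$ on $\prod_{j\in D}\mathcal{X}_j$; for $J\subseteq D$, $V_J\subseteq V_D$ is the subspace of functions depending only on the variables $\mathbf{x}_J=(x_j)_{j\in J}$, and $V_\emptyset=\mathbb{R}$ (constants). Thus $V_{J'}\subseteq V_J$ if $J'\subseteq J$, and any operators $V_D\to V_J$ and $V_D\to V_{J'}$ can be composed (written $\circ$). Put $\setminus J:=D\setminus J$. Operators. $I$ is the identity of $V_D$; $\mathbb{E}:V_D\to\mathbb{R}$, $\mathbb{E}(g)=\mathbb{E}[g(\mathbf{X}_D)]$;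 $\mathbb{E}_{\mathbf{X}_{\setminus J}}:V_D\to V_J$, $\mathbb{E}_{\mathbf{X}_{\setminus J}}(g)(\mathbf{x}_J)=\mathbb{E}[g(\mathbf{x}_J,\mathbf{X}_{\setminus J})]$ (expectation over the marginal law of $\mathbf{X}_{\setminus J}$, with $\mathbf{x}_J$ fixed). Notation $\frac{\partial g}{\partial\mathbf{x}_J}=0$. With $g|_{\mathbf{x}_J=\mathbf{c}}$ denoting substitution, "$\frac{\partial g}{\partial \mathbf{x}_J}=0$" means by definition (no differentiability assumed) that $\sum_{J'\subseteq J}(-1)^{|J'|}g|_{\mathbf{x}_{J'}=\mathbf{a}_{J'}}=0$ identically for every $\mathbf{a}_J\in\prod_{j\in J}\mathcal{X}_j$. A family of linear operators $\{\mathcal{H}_J:V_D\to V_J\}_{J\subseteq D}$ is an interaction decomposition (ID) if, for all $J,J'\subseteq D$: (P1) Unbiasedness: $\mathcal{H}_\emptyset=\mathbb{E}$ and $\mathbb{E}\circ\mathcal{H}_J=0$ for $J\neq\emptyset$. (P2) Relevance: for $g\in V_D$, if $\frac{\partial g}{\partial\mathbf{x}_J}=0$, then $\mathcal{H}_J(g)=0$. (P3) Lean Decomposability: if $g\in V_J$, then $\big(\sum_{J'\subseteq J}\mathcal{H}_{J'}\big)(g)=g$. (P4) Idempotence: $\mathcal{H}_J\circ\mathcal{H}_J=\mathcal{H}_J$. (P5) Operational Orthogonality: if $J'\neq J$, then $\mathcal{H}_{J'}\circ\mathcal{H}_J=0$. (P6) Consistency with PD: when all feature variables $X_1,\dots,X_d$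 are independent, $\sum_{J'\subseteq J}\mathcal{H}_{J'}=\mathbb{E}_{\mathbf{X}_{\setminus J}}$. *)

theory Defs
  imports "HOL-Probability.Probability"
begin

text \<open>
  Points of the product of the \<open>\<X> j\<close> are functions on \<open>{1..d}\<close>, extended by \<open>undefined\<close>
  (as usual for \<open>PiE\<close>). Likewise functions on that product are elements of
  \<open>extensional \<Omega>\<close>, so that two of them are equal iff they agree on \<open>\<Omega>\<close>; real numbers are
  identified with the constant functions on \<open>\<Omega>\<close>.
\<close>

type_synonym fn = "(nat \<Rightarrow> real) \<Rightarrow> real"

locale feature_model = prob_space M for M :: "'a measure" +
  fixes d :: nat and \<X> :: "nat \<Rightarrow> real set" and X :: "nat \<Rightarrow> 'a \<Rightarrow> real"
  assumes d_ge_1: "d \<ge> 1"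
    and compact_values: "j \<in> {1..d} \<Longrightarrow> compact (\<X> j)"
    and nonempty_values: "j \<in> {1..d} \<Longrightarrow> \<X> j \<noteq> {}"
    and random_variable_X: "j \<in> {1..d} \<Longrightarrow> random_variable borel (X j)"
    and X_in_values: "j \<in> {1..d} \<Longrightarrow> \<omega> \<in> space M \<Longrightarrow> X j \<omega> \<in> \<X> j"
begin

definition D :: "nat set" where
  "D = {1..d}"

definition \<Omega> :: "(nat \<Rightarrow> real) set" where
  "\<Omega> = (\<Pi>\<^sub>E j\<in>D. \<X> j)"

definition V :: "nat set \<Rightarrow> fn set" where
  "V J = {g \<in> extensional \<Omega>.
     g \<in> borel_measurable (\<Pi>\<^sub>M j\<in>D. restrict_space borel (\<X> j)) \<and>
     bounded (g ` \<Omega>) \<and>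
     (\<forall>x\<in>\<Omega>. \<forall>y\<in>\<Omega>. (\<forall>j\<in>J. x j = y j) \<longrightarrow> g x = g y)}"

definition linear_operator :: "nat set \<Rightarrow> (fn \<Rightarrow> fn) \<Rightarrow> bool" where
  "linear_operator J T \<longleftrightarrow>
     T \<in> V D \<rightarrow> V J \<and>
     (\<forall>f\<in>V D. \<forall>g\<in>V D. T (\<lambda>x\<in>\<Omega>. f x + g x) = (\<lambda>x\<in>\<Omega>. T f x + T g x)) \<and>
     (\<forall>c. \<forall>f\<in>V D. T (\<lambda>x\<in>\<Omega>. c * f x) = (\<lambda>x\<in>\<Omega>. c * T f x))"

definition full_expectation :: "fn \<Rightarrow> fn" where
  "full_expectation g = (\<lambda>x\<in>\<Omega>. expectation (\<lambda>\<omega>. g (\<lambda>j\<in>D. X j \<omega>)))"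

text \<open>
  Expectation over the variables outside \<open>J\<close>: the coordinates in \<open>J\<close> are frozen at \<open>x\<close>, the
  remaining ones are random with their joint marginal law.
\<close>

definition partial_expectation :: "nat set \<Rightarrow> fn \<Rightarrow> fn" where
  "partial_expectation J g =
     (\<lambda>x\<in>\<Omega>. expectation (\<lambda>\<omega>. g (override_on (\<lambda>j\<in>D. X j \<omega>) x J)))"

text \<open>The relation written \<open>\<partial>g / \<partial>x\<^sub>J = 0\<close>, which presupposes no differentiability.\<close>

definition partial_vanishes :: "nat set \<Rightarrow> fn \<Rightarrow> bool" where
  "partial_vanishes J g \<longleftrightarrow>
     (\<forall>a\<in>(\<Pi>\<^sub>E j\<in>J. \<X> j). \<forall>x\<in>\<Omega>.
        (\<Sum>J'\<in>Pow J. (-1) ^ card J' * g (override_on x a J')) = 0)"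

definition unbiased :: "(nat set \<Rightarrow> fn \<Rightarrow> fn) \<Rightarrow> bool" where
  "unbiased H \<longleftrightarrow>
     (\<forall>g\<in>V D. H {} g = full_expectation g) \<and>
     (\<forall>J\<subseteq>D. J \<noteq> {} \<longrightarrow> (\<forall>g\<in>V D. full_expectation (H J g) = (\<lambda>x\<in>\<Omega>. 0)))"

definition relevant :: "(nat set \<Rightarrow> fn \<Rightarrow> fn) \<Rightarrow> bool" where
  "relevant H \<longleftrightarrow>
     (\<forall>J\<subseteq>D. \<forall>g\<in>V D. partial_vanishes J g \<longrightarrow> H J g = (\<lambda>x\<in>\<Omega>. 0))"

definition lean_decomposable :: "(nat set \<Rightarrow> fn \<Rightarrow> fn) \<Rightarrow> bool" where
  "lean_decomposable H \<longleftrightarrow>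
     (\<forall>J\<subseteq>D. \<forall>g\<in>V J. (\<lambda>x\<in>\<Omega>. \<Sum>J'\<in>Pow J. H J' g x) = g)"

definition idempotent :: "(nat set \<Rightarrow> fn \<Rightarrow> fn) \<Rightarrow> bool" where
  "idempotent H \<longleftrightarrow> (\<forall>J\<subseteq>D. \<forall>g\<in>V D. H J (H J g) = H J g)"

definition operationally_orthogonal :: "(nat set \<Rightarrow> fn \<Rightarrow> fn) \<Rightarrow> bool" where
  "operationally_orthogonal H \<longleftrightarrow>
     (\<forall>J\<subseteq>D. \<forall>J'\<subseteq>D. J' \<noteq> J \<longrightarrow> (\<forall>g\<in>V D. H J' (H J g) = (\<lambda>x\<in>\<Omega>. 0)))"

definition consistent_with_PD :: "(nat set \<Rightarrow> fn \<Rightarrow> fn) \<Rightarrow> bool" where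
  "consistent_with_PD H \<longleftrightarrow>
     (indep_vars (\<lambda>_. borel) X D \<longrightarrow>
       (\<forall>J\<subseteq>D. \<forall>g\<in>V D. (\<lambda>x\<in>\<Omega>. \<Sum>J'\<in>Pow J. H J' g x) = partial_expectation J g))"

definition interaction_decomposition :: "(nat set \<Rightarrow> fn \<Rightarrow> fn) \<Rightarrow> bool" where
  "interaction_decomposition H \<longleftrightarrow>
     (\<forall>J\<subseteq>D. linear_operator J (H J)) \<and>
     unbiased H \<and> relevant H \<and> lean_decomposable H \<and> idempotent H \<and>
     operationally_orthogonal H \<and> consistent_with_PD H"

abbreviation L_PD :: "nat set \<Rightarrow> fn \<Rightarrow> fn" where
  "L_PD \<equiv> partial_expectation"

text \<open>Only the values at \<open>J \<subseteq> D\<close> matter; the case of infinite \<open>J\<close> is there for totality.\<close>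

function H_PD :: "nat set \<Rightarrow> fn \<Rightarrow> fn" where
  "H_PD J =
     (if J = {} \<or> infinite J then full_expectation
      else (\<lambda>h. \<lambda>x\<in>\<Omega>. h x - (\<Sum>J' | J' \<subset> J. H_PD J' h x)) \<circ> L_PD J)"
  by pat_completeness auto
termination
  by (relation finite_psubset) auto

declare H_PD.simps [simp del]

lemma H_PD_empty: "H_PD {} = full_expectation"
  by (simp add: H_PD.simps)

lemma H_PD_nonempty:
  assumes "J \<subseteq> D" and "J \<noteq> {}"
  shows "H_PD J = (\<lambda>h. \<lambda>x\<in>\<Omega>. h x - (\<Sum>J' | J' \<subset> J. H_PD J' h x)) \<circ> L_PD J"
proof -
  have "finite J"
    using assms(1) by (auto simp: D_def intro: finite_subset)
  with assms(2) show ?thesis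
    by (subst H_PD.simps) simp
qed

end

end

theory Submission
  imports Defs
begin

text \<open>
  Since \<open>L_PD J\<close> is the identity on \<open>V J\<close>, the recursion is exactly lean decomposability. Hence \<open>H_PD J\<close>
  annihilates every \<open>g\<close> that does not depend on some \<open>x\<^sub>j\<close> with \<open>j \<in> J\<close>. This gives relevance, because
  \<open>\<partial>g / \<partial>x\<^sub>J = 0\<close> makes \<open>g\<close> a linear combination of such functions, and also
  \<open>H_PD J' \<circ> H_PD J = 0\<close> unless \<open>J' \<subseteq> J\<close>. The case \<open>J' \<subset> J\<close>, idempotence and unbiasedness (\<open>J' = {}\<close>)
  follow by induction on \<open>J\<close>. For independent features, Fubini gives \<open>L_PD J' \<circ> L_PD J = L_PD J'\<close> for
  \<open>J' \<subseteq> J\<close>, so \<open>H_PD J' \<circ> L_PD J = H_PD J'\<close> and the recursion telescopes to consistency with PD.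
\<close>

context feature_model
begin

section \<open>Measurability of the feature vector and of freezing coordinates\<close>

abbreviation N :: "(nat \<Rightarrow> real) measure" where
  "N \<equiv> \<Pi>\<^sub>M j\<in>D. restrict_space borel (\<X> j)"

lemma finite_D: "finite D"
  by (simp add: D_def)

lemma finite_subset_D: "J \<subseteq> D \<Longrightarrow> finite J"
  using finite_D by (rule rev_finite_subset)

lemma space_N: "space N = \<Omega>"
  by (simp add: space_PiM \<Omega>_def space_restrict_space)

lemma override_on_\<Omega>: "x \<in> \<Omega> \<Longrightarrow> y \<in> \<Omega> \<Longrightarrow> override_on y x J \<in> \<Omega>"
  by (auto simp: \<Omega>_def PiE_iff override_on_def extensional_def)

lemma X_in_\<Omega>: "\<omega> \<in> space M \<Longrightarrow> (\<lambda>j\<in>D. X j \<omega>) \<in> \<Omega>"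
  by (auto simp: \<Omega>_def D_def X_in_values)

lemma measurable_X: "j \<in> D \<Longrightarrow> X j \<in> measurable M (restrict_space borel (\<X> j))"
  by (rule measurable_restrict_space2) (auto simp: D_def random_variable_X X_in_values)

lemma measurable_X_vec: "(\<lambda>\<omega>. \<lambda>j\<in>D. X j \<omega>) \<in> measurable M N"
  by (rule measurable_restrict) (rule measurable_X)

text \<open>Coordinatewise form, to which \<open>measurable_restrict\<close> applies;
  \<open>J \<subseteq> D\<close> keeps both sides \<open>undefined\<close> outside
  \<open>D\<close>.\<close>

lemma override_on_X:
  "J \<subseteq> D \<Longrightarrow> override_on (\<lambda>j\<in>D. X j \<omega>) x J = (\<lambda>j\<in>D. if j \<in> J then x j else X j \<omega>)"
  by (auto simp: override_on_def fun_eq_iff)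

lemma measurable_override_on_X:
  assumes "J \<subseteq> D"
  shows "(\<lambda>(x, \<omega>). override_on (\<lambda>j\<in>D. X j \<omega>) x J) \<in> measurable (N \<Otimes>\<^sub>M M) N"
proof -
  have "(\<lambda>p. \<lambda>j\<in>D. if j \<in> J then fst p j else X j (snd p)) \<in> measurable (N \<Otimes>\<^sub>M M) N"
  proof (rule measurable_restrict)
    fix j assume j: "j \<in> D"
    have "(\<lambda>p. fst p j) \<in> measurable (N \<Otimes>\<^sub>M M) (restrict_space borel (\<X> j))"
      by (rule measurable_compose[OF measurable_fst measurable_component_singleton[OF j]])
    moreover have "(\<lambda>p. X j (snd p)) \<in> measurable (N \<Otimes>\<^sub>M M) (restrict_space borel (\<X> j))"
      by (rule measurable_compose[OF measurable_snd measurable_X[OF j]])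
    ultimately show "(\<lambda>p. if j \<in> J then fst p j else X j (snd p))
        \<in> measurable (N \<Otimes>\<^sub>M M) (restrict_space borel (\<X> j))"
      by simp
  qed
  then show ?thesis
    using assms by (simp add: override_on_X case_prod_unfold)
qed

lemma measurable_override_on:
  assumes "x \<in> \<Omega>"
  shows "(\<lambda>y. override_on y x J) \<in> measurable N N"
proof -
  have *: "(\<lambda>y. \<lambda>j\<in>D. if j \<in> J then x j else y j) \<in> measurable N N"
  proof (rule measurable_restrict)
    fix j assume j: "j \<in> D"
    have "x j \<in> space (restrict_space borel (\<X> j))"
      using assms j by (auto simp: \<Omega>_def space_restrict_space)
    moreover have "(\<lambda>y. y j) \<in> measurable N (restrict_space borel (\<X> j))"
      by (rule measurable_component_singleton[OF j])
    ultimately show "(\<lambda>y. if j \<in> J then x j else y j) \<in> measurable N (restrict_space borel (\<X> j))"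
      by (cases "j \<in> J") simp_all
  qed
  \<comment> \<open>Both \<open>x\<close> and \<open>y\<close> lie in \<Omega> and so are
    \<open>undefined\<close> outside \<open>D\<close>, which makes the override extensional as
    well.\<close>
  have "(\<lambda>j\<in>D. if j \<in> J then x j else y j) = override_on y x J" if "y \<in> space N" for y
    using that assms by (auto simp: space_N \<Omega>_def PiE_iff override_on_def extensional_def fun_eq_iff)
  then have "(\<lambda>y. \<lambda>j\<in>D. if j \<in> J then x j else y j) \<in> measurable N N
      \<longleftrightarrow> (\<lambda>y. override_on y x J) \<in> measurable N N"
    by (rule measurable_cong)
  with * show ?thesis by (rule iffD1[rotated])
qed

subsection \<open>The function spaces\<close>

lemma V_I:
  assumes "g \<in> extensional \<Omega>" "g \<in> borel_measurable N"
    and "\<And>x. x \<in> \<Omega> \<Longrightarrow> \<bar>g x\<bar> \<le> B"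
    and "\<And>x y. x \<in> \<Omega> \<Longrightarrow> y \<in> \<Omega> \<Longrightarrow> (\<And>j. j \<in> J \<Longrightarrow> x j = y j) \<Longrightarrow> g x = g y"
  shows "g \<in> V J"
proof -
  have "bounded (g ` \<Omega>)"
    unfolding bounded_iff using assms(3) by auto
  moreover have "g x = g y" if "x \<in> \<Omega>" "y \<in> \<Omega>" "\<forall>j\<in>J. x j = y j" for x y
    using that(3) by (intro assms(4)[OF that(1,2)]) (rule bspec)
  ultimately show ?thesis
    unfolding V_def using assms(1,2) by (intro CollectI conjI ballI impI)
qed

lemma V_bound:
  assumes "g \<in> V J"
  obtains B where "\<And>x. x \<in> \<Omega> \<Longrightarrow> \<bar>g x\<bar> \<le> B"
proof -
  have "bounded (g ` \<Omega>)" using assms unfolding V_def by (elim CollectE conjE)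
  then obtain B where "\<forall>x\<in>\<Omega>. \<bar>g x\<bar> \<le> B" by (auto simp: bounded_iff)
  then show thesis using that by blast
qed

lemma V_measurable: "g \<in> V J \<Longrightarrow> g \<in> borel_measurable N"
  and V_extensional: "g \<in> V J \<Longrightarrow> g \<in> extensional \<Omega>"
  unfolding V_def by (elim CollectE conjE, assumption)+

lemma V_cong:
  assumes "g \<in> V J" "x \<in> \<Omega>" "y \<in> \<Omega>" "\<And>j. j \<in> J \<Longrightarrow> x j = y j"
  shows "g x = g y"
proof -
  have "\<forall>x\<in>\<Omega>. \<forall>y\<in>\<Omega>. (\<forall>j\<in>J. x j = y j) \<longrightarrow> g x = g y"
    using assms(1) unfolding V_def by (elim CollectE conjE)
  then have "\<forall>y\<in>\<Omega>. (\<forall>j\<in>J. x j = y j) \<longrightarrow> g x = g y"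
    using assms(2) by (rule bspec)
  then have "(\<forall>j\<in>J. x j = y j) \<longrightarrow> g x = g y"
    using assms(3) by (rule bspec)
  with assms(4) show ?thesis by simp
qed

lemma V_mono:
  assumes "g \<in> V J" "J \<subseteq> K"
  shows "g \<in> V K"
proof -
  obtain B where B: "\<And>x. x \<in> \<Omega> \<Longrightarrow> \<bar>g x\<bar> \<le> B" using V_bound[OF assms(1)] by blast
  show ?thesis
    using V_extensional[OF assms(1)] V_measurable[OF assms(1)] B
  proof (rule V_I)
    show "g x = g y" if "x \<in> \<Omega>" "y \<in> \<Omega>" "\<And>j. j \<in> K \<Longrightarrow> x j = y j" for x y
      using assms(2) by (intro V_cong[OF assms(1) that]) (rule subsetD)
  qed
qed

lemma V_restrict_id: "g \<in> V J \<Longrightarrow> (\<lambda>x\<in>\<Omega>. g x) = g"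
  by (simp add: V_extensional extensional_restrict)

lemma measurable_restrict_\<Omega>:
  fixes f :: fn
  assumes "f \<in> borel_measurable N"
  shows "(\<lambda>x\<in>\<Omega>. f x) \<in> borel_measurable N"
proof -
  have "(\<lambda>x\<in>\<Omega>. f x) \<in> borel_measurable N \<longleftrightarrow> f \<in> borel_measurable N"
    by (rule measurable_cong) (simp add: space_N)
  with assms show ?thesis by (rule iffD2[rotated])
qed

lemma V_scale: "g \<in> V J \<Longrightarrow> (\<lambda>x\<in>\<Omega>. c * g x) \<in> V J"
proof -
  assume g: "g \<in> V J"
  obtain B where B: "\<And>x. x \<in> \<Omega> \<Longrightarrow> \<bar>g x\<bar> \<le> B" using V_bound[OF g] by blast
  show ?thesis
  proof (rule V_I[where B = "\<bar>c\<bar> * B"])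
    show "(\<lambda>x\<in>\<Omega>. c * g x) \<in> borel_measurable N"
      using V_measurable[OF g] by (intro measurable_restrict_\<Omega>) simp
    show "\<bar>(\<lambda>x\<in>\<Omega>. c * g x) x\<bar> \<le> \<bar>c\<bar> * B" if "x \<in> \<Omega>" for x
      using that B by (simp add: abs_mult mult_left_mono)
    show "(\<lambda>x\<in>\<Omega>. c * g x) x = (\<lambda>x\<in>\<Omega>. c * g x) y"
      if "x \<in> \<Omega>" "y \<in> \<Omega>" "\<And>j. j \<in> J \<Longrightarrow> x j = y j" for x y
      using V_cong[OF g that] that by simp
  qed simp
qed

lemma V_add: "f \<in> V J \<Longrightarrow> g \<in> V J \<Longrightarrow> (\<lambda>x\<in>\<Omega>. f x + g x) \<in> V J"
proof -
  assume f: "f \<in> V J" and g: "g \<in> V J"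
  obtain A B where A: "\<And>x. x \<in> \<Omega> \<Longrightarrow> \<bar>f x\<bar> \<le> A" and B: "\<And>x. x \<in> \<Omega> \<Longrightarrow> \<bar>g x\<bar> \<le> B"
    using V_bound[OF f] V_bound[OF g] by metis
  show ?thesis
  proof (rule V_I[where B = "A + B"])
    show "(\<lambda>x\<in>\<Omega>. f x + g x) \<in> borel_measurable N"
      using V_measurable[OF f] V_measurable[OF g] by (intro measurable_restrict_\<Omega>) simp
    show "\<bar>(\<lambda>x\<in>\<Omega>. f x + g x) x\<bar> \<le> A + B" if "x \<in> \<Omega>" for x
      using A[OF that] B[OF that] that by simp
    show "(\<lambda>x\<in>\<Omega>. f x + g x) x = (\<lambda>x\<in>\<Omega>. f x + g x) y"
      if "x \<in> \<Omega>" "y \<in> \<Omega>" "\<And>j. j \<in> J \<Longrightarrow> x j = y j" for x y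
      using V_cong[OF f that] V_cong[OF g that] that by simp
  qed simp
qed

lemma V_zero: "(\<lambda>x\<in>\<Omega>. 0) \<in> V J"
proof (rule V_I[where B = 0])
  show "(\<lambda>x\<in>\<Omega>. 0 :: real) \<in> borel_measurable N"
    by (rule measurable_restrict_\<Omega>) simp
qed simp_all

lemma V_sum:
  assumes "\<And>i. i \<in> A \<Longrightarrow> f i \<in> V J"
  shows "(\<lambda>x\<in>\<Omega>. \<Sum>i\<in>A. c i * f i x) \<in> V J"
  using assms
proof (induction A rule: infinite_finite_induct)
  case (insert i A)
  have "(\<lambda>x\<in>\<Omega>. (\<lambda>x\<in>\<Omega>. c i * f i x) x + (\<lambda>x\<in>\<Omega>. \<Sum>i\<in>A. c i * f i x) x) \<in> V J"
    using insert by (intro V_add V_scale) auto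
  also have "(\<lambda>x\<in>\<Omega>. (\<lambda>x\<in>\<Omega>. c i * f i x) x + (\<lambda>x\<in>\<Omega>. \<Sum>i\<in>A. c i * f i x) x)
      = (\<lambda>x\<in>\<Omega>. \<Sum>i\<in>insert i A. c i * f i x)"
    using insert.hyps by (intro restrict_ext) simp
  finally show ?case .
qed (simp_all add: V_zero)

subsection \<open>Linear operators\<close>

lemma linear_operator_in: "linear_operator J T \<Longrightarrow> g \<in> V D \<Longrightarrow> T g \<in> V J"
  unfolding linear_operator_def by blast

lemma linear_operator_add:
  "linear_operator J T \<Longrightarrow> f \<in> V D \<Longrightarrow> g \<in> V D \<Longrightarrow>
    T (\<lambda>x\<in>\<Omega>. f x + g x) = (\<lambda>x\<in>\<Omega>. T f x + T g x)"
  and linear_operator_scale: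
  "linear_operator J T \<Longrightarrow> f \<in> V D \<Longrightarrow> T (\<lambda>x\<in>\<Omega>. c * f x) = (\<lambda>x\<in>\<Omega>. c * T f x)"
  unfolding linear_operator_def by blast+

lemma linear_operator_zero: "linear_operator J T \<Longrightarrow> T (\<lambda>x\<in>\<Omega>. 0) = (\<lambda>x\<in>\<Omega>. 0)"
  using linear_operator_scale[of J T "\<lambda>x\<in>\<Omega>. 0" 0] V_zero by simp

text \<open>General coefficients \<open>c i\<close> serve both the signs of the alternating sum in
  relevance and the coefficients \<open>- 1\<close> of the recursion.\<close>

lemma linear_operator_sum:
  assumes T: "linear_operator J T" and "\<And>i. i \<in> A \<Longrightarrow> f i \<in> V D"
  shows "T (\<lambda>x\<in>\<Omega>. \<Sum>i\<in>A. c i * f i x) = (\<lambda>x\<in>\<Omega>. \<Sum>i\<in>A. c i * T (f i) x)"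
  using assms(2)
proof (induction A rule: infinite_finite_induct)
  case (insert i A)
  have "T (\<lambda>x\<in>\<Omega>. (\<lambda>x\<in>\<Omega>. c i * f i x) x + (\<lambda>x\<in>\<Omega>. \<Sum>i\<in>A. c i * f i x) x)
      = (\<lambda>x\<in>\<Omega>. T (\<lambda>x\<in>\<Omega>. c i * f i x) x + T (\<lambda>x\<in>\<Omega>. \<Sum>i\<in>A. c i * f i x) x)"
    using insert by (intro linear_operator_add[OF T] V_scale V_sum) auto
  also have "T (\<lambda>x\<in>\<Omega>. c i * f i x) = (\<lambda>x\<in>\<Omega>. c i * T (f i) x)"
    by (rule linear_operator_scale[OF T]) (rule insert.prems, simp)
  also have "T (\<lambda>x\<in>\<Omega>. \<Sum>i\<in>A. c i * f i x) = (\<lambda>x\<in>\<Omega>. \<Sum>i\<in>A. c i * T (f i) x)"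
    by (rule insert.IH) (rule insert.prems, simp)
  also have "(\<lambda>x\<in>\<Omega>. (\<lambda>x\<in>\<Omega>. c i * T (f i) x) x + (\<lambda>x\<in>\<Omega>. \<Sum>i\<in>A. c i * T (f i) x) x)
      = (\<lambda>x\<in>\<Omega>. \<Sum>i\<in>insert i A. c i * T (f i) x)"
    using insert.hyps by (intro restrict_ext) simp
  also have "(\<lambda>x\<in>\<Omega>. (\<lambda>x\<in>\<Omega>. c i * f i x) x + (\<lambda>x\<in>\<Omega>. \<Sum>i\<in>A. c i * f i x) x)
      = (\<lambda>x\<in>\<Omega>. \<Sum>i\<in>insert i A. c i * f i x)"
    using insert.hyps by (intro restrict_ext) simp
  finally show ?case .
qed (simp_all add: linear_operator_zero[OF T])

lemma V_diff_sum:
  assumes "f \<in> V J" "\<And>i. i \<in> A \<Longrightarrow> h i \<in> V J"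
  shows "(\<lambda>x\<in>\<Omega>. f x - (\<Sum>i\<in>A. h i x)) \<in> V J"
proof -
  have "(\<lambda>x\<in>\<Omega>. f x + (\<lambda>x\<in>\<Omega>. \<Sum>i\<in>A. (- 1) * h i x) x) \<in> V J"
    using assms by (intro V_add V_sum)
  also have "(\<lambda>x\<in>\<Omega>. f x + (\<lambda>x\<in>\<Omega>. \<Sum>i\<in>A. (- 1) * h i x) x) = (\<lambda>x\<in>\<Omega>. f x - (\<Sum>i\<in>A. h i x))"
    by (intro restrict_ext) (simp add: sum_negf)
  finally show ?thesis .
qed

lemma linear_operator_diff_sum:
  assumes T: "linear_operator J T" and f: "f \<in> V D" and h: "\<And>i. i \<in> A \<Longrightarrow> h i \<in> V D"
  shows "T (\<lambda>x\<in>\<Omega>. f x - (\<Sum>i\<in>A. h i x)) = (\<lambda>x\<in>\<Omega>. T f x - (\<Sum>i\<in>A. T (h i) x))"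
proof -
  have "T (\<lambda>x\<in>\<Omega>. f x + (\<lambda>x\<in>\<Omega>. \<Sum>i\<in>A. (- 1) * h i x) x)
      = (\<lambda>x\<in>\<Omega>. T f x + T (\<lambda>x\<in>\<Omega>. \<Sum>i\<in>A. (- 1) * h i x) x)"
    using f h by (intro linear_operator_add[OF T] V_sum)
  also have "T (\<lambda>x\<in>\<Omega>. \<Sum>i\<in>A. (- 1) * h i x) = (\<lambda>x\<in>\<Omega>. \<Sum>i\<in>A. (- 1) * T (h i) x)"
    using h by (rule linear_operator_sum[OF T])
  also have "(\<lambda>x\<in>\<Omega>. T f x + (\<lambda>x\<in>\<Omega>. \<Sum>i\<in>A. (- 1) * T (h i) x) x)
      = (\<lambda>x\<in>\<Omega>. T f x - (\<Sum>i\<in>A. T (h i) x))"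
    by (intro restrict_ext) (simp add: sum_negf)
  also have "(\<lambda>x\<in>\<Omega>. f x + (\<lambda>x\<in>\<Omega>. \<Sum>i\<in>A. (- 1) * h i x) x) = (\<lambda>x\<in>\<Omega>. f x - (\<Sum>i\<in>A. h i x))"
    by (intro restrict_ext) (simp add: sum_negf)
  finally show ?thesis .
qed

subsection \<open>Partial expectations\<close>

text \<open>Boundedness and measurability suffice because \<open>M\<close> is a probability
  measure.\<close>

lemma integrable_V:
  assumes "g \<in> V K" "Y \<in> measurable M N"
  shows "integrable M (\<lambda>\<omega>. g (Y \<omega>))"
proof -
  obtain B where B: "\<And>x. x \<in> \<Omega> \<Longrightarrow> \<bar>g x\<bar> \<le> B" using V_bound[OF assms(1)] by blast
  show ?thesis
  proof (rule integrable_const_bound[where B = B])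
    show "AE \<omega> in M. norm (g (Y \<omega>)) \<le> B"
      using B measurable_space[OF assms(2)] by (auto simp: space_N)
    show "(\<lambda>\<omega>. g (Y \<omega>)) \<in> borel_measurable M"
      using assms(2) V_measurable[OF assms(1)] by (rule measurable_compose)
  qed
qed

lemma measurable_section_X:
  assumes "J \<subseteq> D" "x \<in> \<Omega>"
  shows "(\<lambda>\<omega>. override_on (\<lambda>j\<in>D. X j \<omega>) x J) \<in> measurable M N"
  using measurable_compose[OF measurable_X_vec measurable_override_on[OF assms(2)]] .

text \<open>Averaging removes the coordinates outside \<open>J\<close> and creates no dependence
  that \<open>g\<close> lacks. With \<open>K = D\<close> this gives the target space
  \<open>V J\<close>; with \<open>K = D - {j}\<close> it preserves independence of the coordinate
  \<open>j\<close>.\<close>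

lemma partial_expectation_in_V:
  assumes J: "J \<subseteq> D" and g: "g \<in> V K"
  shows "partial_expectation J g \<in> V (J \<inter> K)"
proof -
  obtain B where B: "\<And>x. x \<in> \<Omega> \<Longrightarrow> \<bar>g x\<bar> \<le> B" using V_bound[OF g] by blast
  show ?thesis
  proof (rule V_I[where B = B])
    show "partial_expectation J g \<in> extensional \<Omega>"
      by (simp add: partial_expectation_def)
    have "(\<lambda>p. g (case p of (x, \<omega>) \<Rightarrow> override_on (\<lambda>j\<in>D. X j \<omega>) x J)) \<in> borel_measurable (N \<Otimes>\<^sub>M M)"
      using measurable_override_on_X[OF J] V_measurable[OF g] by (rule measurable_compose)
    then have "(\<lambda>x. expectation (\<lambda>\<omega>. g (override_on (\<lambda>j\<in>D. X j \<omega>) x J))) \<in> borel_measurable N"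
      by (intro borel_measurable_lebesgue_integral) (simp add: case_prod_unfold)
    then show "partial_expectation J g \<in> borel_measurable N"
      unfolding partial_expectation_def by (rule measurable_restrict_\<Omega>)
    show "\<bar>partial_expectation J g x\<bar> \<le> B" if x: "x \<in> \<Omega>" for x
    proof -
      have int: "integrable M (\<lambda>\<omega>. g (override_on (\<lambda>j\<in>D. X j \<omega>) x J))"
        by (rule integrable_V[OF g measurable_section_X[OF J x]])
      have b: "\<bar>g (override_on (\<lambda>j\<in>D. X j \<omega>) x J)\<bar> \<le> B" if "\<omega> \<in> space M" for \<omega>
        using B x that by (simp add: override_on_\<Omega> X_in_\<Omega>)
      have "\<bar>expectation (\<lambda>\<omega>. g (override_on (\<lambda>j\<in>D. X j \<omega>) x J))\<bar>
          \<le> expectation (\<lambda>\<omega>. \<bar>g (override_on (\<lambda>j\<in>D. X j \<omega>) x J)\<bar>)"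
        by (rule integral_abs_bound)
      also have "\<dots> \<le> expectation (\<lambda>\<omega>. B)"
        using int b by (intro integral_mono) auto
      finally show ?thesis
        using x by (simp add: partial_expectation_def prob_space)
    qed
    show "partial_expectation J g x = partial_expectation J g y"
      if xy: "x \<in> \<Omega>" "y \<in> \<Omega>" "\<And>j. j \<in> J \<inter> K \<Longrightarrow> x j = y j" for x y
    proof -
      \<comment> \<open>The two points agree on \<open>K\<close>: on \<open>J \<inter> K\<close> by
        assumption, and on \<open>K - J\<close> because both carry the same random values.\<close>
      have "g (override_on (\<lambda>j\<in>D. X j \<omega>) x J) = g (override_on (\<lambda>j\<in>D. X j \<omega>) y J)"
        if "\<omega> \<in> space M" for \<omega>
        using xy that by (intro V_cong[OF g]) (simp_all add: override_on_\<Omega> X_in_\<Omega>, auto simp: override_on_def)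
      then show ?thesis
        using xy(1,2) by (auto simp: partial_expectation_def intro: Bochner_Integration.integral_cong)
    qed
  qed
qed

lemma linear_operator_partial_expectation:
  assumes J: "J \<subseteq> D"
  shows "linear_operator J (partial_expectation J)"
proof -
  let ?Y = "\<lambda>x \<omega>. override_on (\<lambda>j\<in>D. X j \<omega>) x J"
  \<comment> \<open>Since these points stay in \<Omega>, restricted functions can be evaluated at
    them under the expectation.\<close>
  have Y: "?Y x \<omega> \<in> \<Omega>" if "x \<in> \<Omega>" "\<omega> \<in> space M" for x \<omega>
    using that by (simp add: override_on_\<Omega> X_in_\<Omega>)
  have "partial_expectation J f \<in> V J" if "f \<in> V D" for f
    using partial_expectation_in_V[OF J that] J by (simp add: Int_absorb2)
  moreover have "partial_expectation J (\<lambda>x\<in>\<Omega>. f x + g x)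
      = (\<lambda>x\<in>\<Omega>. partial_expectation J f x + partial_expectation J g x)"
    if f: "f \<in> V D" and g: "g \<in> V D" for f g
  proof -
    have "expectation (\<lambda>\<omega>. (\<lambda>x\<in>\<Omega>. f x + g x) (?Y x \<omega>))
        = expectation (\<lambda>\<omega>. f (?Y x \<omega>)) + expectation (\<lambda>\<omega>. g (?Y x \<omega>))" if x: "x \<in> \<Omega>" for x
    proof -
      have "expectation (\<lambda>\<omega>. (\<lambda>x\<in>\<Omega>. f x + g x) (?Y x \<omega>)) = expectation (\<lambda>\<omega>. f (?Y x \<omega>) + g (?Y x \<omega>))"
        using Y[OF x] by (intro Bochner_Integration.integral_cong) auto
      also have "\<dots> = expectation (\<lambda>\<omega>. f (?Y x \<omega>)) + expectation (\<lambda>\<omega>. g (?Y x \<omega>))"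
        by (intro Bochner_Integration.integral_add integrable_V[OF f] integrable_V[OF g]
            measurable_section_X J x)
      finally show ?thesis .
    qed
    then show ?thesis
      by (simp add: partial_expectation_def cong: restrict_cong)
  qed
  moreover have "partial_expectation J (\<lambda>x\<in>\<Omega>. c * f x) = (\<lambda>x\<in>\<Omega>. c * partial_expectation J f x)" for c f
  proof -
    have "expectation (\<lambda>\<omega>. (\<lambda>x\<in>\<Omega>. c * f x) (?Y x \<omega>)) = c * expectation (\<lambda>\<omega>. f (?Y x \<omega>))"
      if x: "x \<in> \<Omega>" for x
    proof -
      have "expectation (\<lambda>\<omega>. (\<lambda>x\<in>\<Omega>. c * f x) (?Y x \<omega>)) = expectation (\<lambda>\<omega>. c * f (?Y x \<omega>))"
        using Y[OF x] by (intro Bochner_Integration.integral_cong) auto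
      then show ?thesis by simp
    qed
    then show ?thesis
      by (simp add: partial_expectation_def cong: restrict_cong)
  qed
  ultimately show ?thesis
    by (auto simp: linear_operator_def)
qed

text \<open>All coordinates that \<open>g\<close> sees are frozen, so the integrand is the constant
  \<open>g x\<close>, and \<open>M\<close> has total mass one.\<close>

lemma partial_expectation_id:
  assumes "g \<in> V J"
  shows "partial_expectation J g = g"
proof -
  have "expectation (\<lambda>\<omega>. g (override_on (\<lambda>j\<in>D. X j \<omega>) x J)) = g x" if x: "x \<in> \<Omega>" for x
  proof -
    have "g (override_on (\<lambda>j\<in>D. X j \<omega>) x J) = g x" if "\<omega> \<in> space M" for \<omega>
      using that x by (intro V_cong[OF assms]) (auto simp: override_on_\<Omega> X_in_\<Omega>)
    then have "expectation (\<lambda>\<omega>. g (override_on (\<lambda>j\<in>D. X j \<omega>) x J)) = expectation (\<lambda>\<omega>. g x)"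
      by (intro Bochner_Integration.integral_cong) auto
    then show ?thesis by (simp add: prob_space)
  qed
  then show ?thesis
    using V_restrict_id[OF assms] by (simp add: partial_expectation_def cong: restrict_cong)
qed

lemma full_expectation_eq: "full_expectation = partial_expectation {}"
  by (simp add: fun_eq_iff full_expectation_def partial_expectation_def)

section \<open>Iterated expectations of independent features\<close>

text \<open>Independence is given for Borel sets of the reals, whereas functions in
  \<open>V D\<close> are measurable for the product of the restricted spaces. Composing each feature
  with a Borel retraction onto \<open>\<X> j\<close> transfers independence and changes no value on
  the sample space.\<close>

lemma indep_vars_restricted_values:
  assumes "indep_vars (\<lambda>_. borel) X D"
  obtains Y where "indep_vars (\<lambda>j. restrict_space borel (\<X> j)) Y D"
    and "\<And>j \<omega>. j \<in> D \<Longrightarrow> \<omega> \<in> space M \<Longrightarrow> Y j \<omega> = X j \<omega>"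
proof -
  \<comment> \<open>The retraction is Borel because the compact set \<open>\<X> j\<close> is closed;
    points outside go to one chosen element, which exists because \<open>\<X> j\<close> is
    nonempty.\<close>
  define c where "c j t = (if t \<in> \<X> j then t else (SOME s. s \<in> \<X> j))" for j t
  have "c j \<in> measurable borel (restrict_space borel (\<X> j))" if j: "j \<in> D" for j
  proof (rule measurable_restrict_space2)
    show "c j \<in> space borel \<rightarrow> \<X> j"
      using j nonempty_values by (auto simp: c_def D_def some_in_eq)
    have "\<X> j \<in> sets borel"
      using j compact_values by (simp add: D_def compact_imp_closed)
    then show "c j \<in> borel_measurable borel"
      unfolding c_def by simp
  qed
  then have "indep_vars (\<lambda>j. restrict_space borel (\<X> j)) (\<lambda>j \<omega>. c j (X j \<omega>)) D"
    by (rule indep_vars_compose2[OF assms])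
  moreover have "c j (X j \<omega>) = X j \<omega>" if "j \<in> D" "\<omega> \<in> space M" for j \<omega>
    using that X_in_values by (simp add: c_def D_def)
  ultimately show thesis by (rule that)
qed

text \<open>Taking the coordinates in \<open>J\<close> from one draw and the others from a second,
  independent draw does not change the law of the feature vector: the blocks \<open>J\<close> and
  \<open>D - J\<close> are independent, so their joint law is a product and Fubini applies.\<close>

lemma expectation_override_on_indep:
  assumes indep: "indep_vars (\<lambda>_. borel) X D" and J: "J \<subseteq> D" and h: "h \<in> V D"
  shows "expectation (\<lambda>\<omega>. expectation (\<lambda>\<omega>'. h (override_on (\<lambda>j\<in>D. X j \<omega>') (\<lambda>j\<in>D. X j \<omega>) J)))
    = expectation (\<lambda>\<omega>. h (\<lambda>j\<in>D. X j \<omega>))"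
proof -
  obtain Y where Y: "indep_vars (\<lambda>j. restrict_space borel (\<X> j)) Y D"
    and YX: "\<And>j \<omega>. j \<in> D \<Longrightarrow> \<omega> \<in> space M \<Longrightarrow> Y j \<omega> = X j \<omega>"
    using indep_vars_restricted_values[OF indep] by blast
  define K where "K = D - J"
  define R where "R A = (\<Pi>\<^sub>M j\<in>A. restrict_space borel (\<X> j))" for A
  define Z where "Z A \<omega> = (\<lambda>j\<in>A. Y j \<omega>)" for A \<omega>
  \<comment> \<open>\<open>F\<close> reads \<open>h\<close> as a function of the two blocks of
    coordinates, indexed by \<open>J\<close> and by \<open>K\<close>.\<close>
  define F where "F p = h (merge J K p)" for p
  have JK: "J \<union> K = D" "J \<inter> K = {}" using J by (auto simp: K_def)
  have ind: "indep_var (R J) (Z J) (R K) (Z K)"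
    unfolding R_def Z_def using JK by (intro indep_var_restrict[OF Y]) auto
  have ZJ: "Z J \<in> measurable M (R J)" and ZK: "Z K \<in> measurable M (R K)"
    using indep_var_rv1[OF ind] indep_var_rv2[OF ind] .
  have mer: "merge J K \<in> measurable (R J \<Otimes>\<^sub>M R K) N"
    using measurable_merge[of J K] by (simp add: R_def JK)
  have F: "F \<in> borel_measurable (R J \<Otimes>\<^sub>M R K)"
    unfolding F_def using mer V_measurable[OF h] by (rule measurable_compose)
  interpret PJ: prob_space "distr M (R J) (Z J)" by (rule prob_space_distr[OF ZJ])
  interpret PK: prob_space "distr M (R K) (Z K)" by (rule prob_space_distr[OF ZK])
  interpret P: pair_prob_space "distr M (R J) (Z J)" "distr M (R K) (Z K)" ..
  obtain B where B: "\<And>x. x \<in> \<Omega> \<Longrightarrow> \<bar>h x\<bar> \<le> B" using V_bound[OF h] by blast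
  have int: "integrable (distr M (R J) (Z J) \<Otimes>\<^sub>M distr M (R K) (Z K)) F"
  proof (rule P.integrable_const_bound[where B = B])
    show "AE p in distr M (R J) (Z J) \<Otimes>\<^sub>M distr M (R K) (Z K). norm (F p) \<le> B"
    proof (rule AE_I2)
      fix p assume "p \<in> space (distr M (R J) (Z J) \<Otimes>\<^sub>M distr M (R K) (Z K))"
      then have "merge J K p \<in> \<Omega>"
        using measurable_space[OF mer] by (simp add: space_pair_measure space_N)
      then show "norm (F p) \<le> B" using B by (simp add: F_def)
    qed
    show "F \<in> borel_measurable (distr M (R J) (Z J) \<Otimes>\<^sub>M distr M (R K) (Z K))"
      using F by simp
  qed
  have sec: "(\<lambda>v. F (u, v)) \<in> borel_measurable (R K)" if "u \<in> space (R J)" for u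
    using F that by simp
  have out: "(\<lambda>u. \<integral>v. F (u, v) \<partial>distr M (R K) (Z K)) \<in> borel_measurable (R J)"
    using F by (intro PK.borel_measurable_lebesgue_integral) simp
  have "expectation (\<lambda>\<omega>. h (\<lambda>j\<in>D. X j \<omega>)) = expectation (\<lambda>\<omega>. F (Z J \<omega>, Z K \<omega>))"
  proof (rule Bochner_Integration.integral_cong[OF refl])
    fix \<omega> assume "\<omega> \<in> space M"
    then have "(\<lambda>j\<in>D. X j \<omega>) = merge J K (Z J \<omega>, Z K \<omega>)"
      using JK by (auto simp: fun_eq_iff merge_def Z_def YX)
    then show "h (\<lambda>j\<in>D. X j \<omega>) = F (Z J \<omega>, Z K \<omega>)" by (simp add: F_def)
  qed
  also have "\<dots> = integral\<^sup>L (distr M (R J \<Otimes>\<^sub>M R K) (\<lambda>\<omega>. (Z J \<omega>, Z K \<omega>))) F"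
    using ZJ ZK F by (intro integral_distr[symmetric]) simp_all
  \<comment> \<open>Independence enters here: the joint law of the two blocks equals the product of
    their laws.\<close>
  also have "\<dots> = integral\<^sup>L (distr M (R J) (Z J) \<Otimes>\<^sub>M distr M (R K) (Z K)) F"
    using ind by (simp add: indep_var_distribution_eq)
  also have "\<dots> = (\<integral>u. \<integral>v. F (u, v) \<partial>distr M (R K) (Z K) \<partial>distr M (R J) (Z J))"
    by (rule P.integral_fst'[OF int, symmetric])
  also have "\<dots> = expectation (\<lambda>\<omega>. \<integral>v. F (Z J \<omega>, v) \<partial>distr M (R K) (Z K))"
    by (rule integral_distr[OF ZJ out])
  also have "\<dots> = expectation (\<lambda>\<omega>. expectation (\<lambda>\<omega>'. F (Z J \<omega>, Z K \<omega>')))"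
    using measurable_space[OF ZJ]
    by (intro Bochner_Integration.integral_cong[OF refl] integral_distr[OF ZK sec]) auto
  also have "\<dots> = expectation (\<lambda>\<omega>. expectation (\<lambda>\<omega>'. h (override_on (\<lambda>j\<in>D. X j \<omega>') (\<lambda>j\<in>D. X j \<omega>) J)))"
  proof (intro Bochner_Integration.integral_cong[OF refl])
    fix \<omega> \<omega>' assume "\<omega> \<in> space M" "\<omega>' \<in> space M"
    then have "merge J K (Z J \<omega>, Z K \<omega>') = override_on (\<lambda>j\<in>D. X j \<omega>') (\<lambda>j\<in>D. X j \<omega>) J"
      using JK by (auto simp: fun_eq_iff merge_def Z_def YX override_on_def)
    then show "F (Z J \<omega>, Z K \<omega>') = h (override_on (\<lambda>j\<in>D. X j \<omega>') (\<lambda>j\<in>D. X j \<omega>) J)"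
      by (simp add: F_def)
  qed
  finally show ?thesis ..
qed

text \<open>Coordinates in \<open>J\<close> are overwritten by the fixed \<open>x\<close>, so only
  those in \<open>D - J\<close> still matter. Such sections serve both the iterated expectations and
  the terms of the alternating sum in relevance.\<close>

lemma V_section:
  assumes g: "g \<in> V D" and x: "x \<in> \<Omega>"
  shows "(\<lambda>y\<in>\<Omega>. g (override_on y x J)) \<in> V (D - J)"
proof -
  obtain B where B: "\<And>x. x \<in> \<Omega> \<Longrightarrow> \<bar>g x\<bar> \<le> B" using V_bound[OF g] by blast
  show ?thesis
  proof (rule V_I[where B = B])
    show "(\<lambda>y\<in>\<Omega>. g (override_on y x J)) \<in> borel_measurable N"
      using measurable_compose[OF measurable_override_on[OF x] V_measurable[OF g]]
      by (rule measurable_restrict_\<Omega>)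
    show "\<bar>(\<lambda>y\<in>\<Omega>. g (override_on y x J)) y\<bar> \<le> B" if "y \<in> \<Omega>" for y
      using that B x by (simp add: override_on_\<Omega>)
    show "(\<lambda>y\<in>\<Omega>. g (override_on y x J)) y = (\<lambda>y\<in>\<Omega>. g (override_on y x J)) z"
      if "y \<in> \<Omega>" "z \<in> \<Omega>" "\<And>j. j \<in> D - J \<Longrightarrow> y j = z j" for y z
    proof -
      have "g (override_on y x J) = g (override_on z x J)"
        using that x by (intro V_cong[OF g]) (simp_all add: override_on_\<Omega>, auto simp: override_on_def)
      with that show ?thesis by simp
    qed
  qed simp
qed

text \<open>For fixed \<open>x\<close>, the section of \<open>g\<close> with \<open>K\<close> frozen
  at \<open>x\<close> is averaged in two stages: the outer expectation draws a feature vector, the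
  inner one redraws its coordinates outside \<open>J\<close>. Independence makes the redraw
  invisible on average.\<close>

lemma partial_expectation_comp_indep:
  assumes indep: "indep_vars (\<lambda>_. borel) X D" and KJ: "K \<subseteq> J" and J: "J \<subseteq> D" and g: "g \<in> V D"
  shows "partial_expectation K (partial_expectation J g) = partial_expectation K g"
proof -
  have "expectation (\<lambda>\<omega>. partial_expectation J g (override_on (\<lambda>j\<in>D. X j \<omega>) x K))
      = expectation (\<lambda>\<omega>. g (override_on (\<lambda>j\<in>D. X j \<omega>) x K))" if x: "x \<in> \<Omega>" for x
  proof -
    define h where "h = (\<lambda>y\<in>\<Omega>. g (override_on y x K))"
    have h: "h \<in> V D"
      unfolding h_def using V_section[OF g x, of K] by (rule V_mono) auto
    \<comment> \<open>Since \<open>K \<subseteq> J\<close>, the redraw never touches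
      \<open>K\<close>, so freezing \<open>K\<close> at \<open>x\<close> may be done last.\<close>
    have swap: "override_on y (override_on z x K) J = override_on (override_on y z J) x K"
      for y z :: "nat \<Rightarrow> real"
      using KJ by (auto simp: override_on_def fun_eq_iff)
    have "expectation (\<lambda>\<omega>. partial_expectation J g (override_on (\<lambda>j\<in>D. X j \<omega>) x K))
        = expectation (\<lambda>\<omega>. expectation (\<lambda>\<omega>'. h (override_on (\<lambda>j\<in>D. X j \<omega>') (\<lambda>j\<in>D. X j \<omega>) J)))"
    proof (rule Bochner_Integration.integral_cong[OF refl])
      fix \<omega> assume \<omega>: "\<omega> \<in> space M"
      have "partial_expectation J g (override_on (\<lambda>j\<in>D. X j \<omega>) x K)
          = expectation (\<lambda>\<omega>'. g (override_on (\<lambda>j\<in>D. X j \<omega>') (override_on (\<lambda>j\<in>D. X j \<omega>) x K) J))"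
        using \<omega> x by (simp add: partial_expectation_def override_on_\<Omega> X_in_\<Omega>)
      also have "\<dots> = expectation (\<lambda>\<omega>'. h (override_on (\<lambda>j\<in>D. X j \<omega>') (\<lambda>j\<in>D. X j \<omega>) J))"
        using \<omega> by (intro Bochner_Integration.integral_cong[OF refl])
          (simp add: swap h_def override_on_\<Omega> X_in_\<Omega>)
      finally show "partial_expectation J g (override_on (\<lambda>j\<in>D. X j \<omega>) x K)
          = expectation (\<lambda>\<omega>'. h (override_on (\<lambda>j\<in>D. X j \<omega>') (\<lambda>j\<in>D. X j \<omega>) J))" .
    qed
    also have "\<dots> = expectation (\<lambda>\<omega>. h (\<lambda>j\<in>D. X j \<omega>))"
      by (rule expectation_override_on_indep[OF indep J h])
    also have "\<dots> = expectation (\<lambda>\<omega>. g (override_on (\<lambda>j\<in>D. X j \<omega>) x K))"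
      by (intro Bochner_Integration.integral_cong[OF refl]) (simp add: h_def X_in_\<Omega>)
    finally show ?thesis .
  qed
  then show ?thesis
    unfolding partial_expectation_def[of K] by (simp cong: restrict_cong)
qed

subsection \<open>The PD-based decomposition\<close>

text \<open>The base case fits the general recursion: \<open>L_PD {}\<close> is the full expectation
  and the sum over proper subsets is empty. Inductions thus need no separate case for the empty
  set.\<close>

lemma H_PD_eq:
  assumes "J \<subseteq> D"
  shows "H_PD J g = (\<lambda>x\<in>\<Omega>. L_PD J g x - (\<Sum>J' | J' \<subset> J. H_PD J' (L_PD J g) x))"
proof (cases "J = {}")
  case True
  then show ?thesis
    by (auto simp: H_PD_empty full_expectation_eq partial_expectation_def fun_eq_iff)
next
  case False
  with assms show ?thesis by (simp add: H_PD_nonempty)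
qed

lemma L_PD_in_V_D: "J \<subseteq> D \<Longrightarrow> g \<in> V D \<Longrightarrow> L_PD J g \<in> V D"
  using linear_operator_in[OF linear_operator_partial_expectation] V_mono by blast

text \<open>Induction adapted to the recursion of \<open>H_PD\<close>; finiteness of
  \<open>D\<close> makes it well-founded, and \<open>J \<subseteq> D\<close> is handed down to the
  smaller sets.\<close>

lemma subset_induct_D [consumes 1, case_names psubset]:
  assumes "J \<subseteq> D" "\<And>J. J \<subseteq> D \<Longrightarrow> (\<And>J'. J' \<subset> J \<Longrightarrow> P J') \<Longrightarrow> P J"
  shows "P J"
  using finite_subset_D[OF assms(1)] assms(1)
proof (induction J rule: finite_psubset_induct)
  case (psubset J)
  show ?case
    using psubset.prems
  proof (rule assms(2))
    show "P J'" if "J' \<subset> J" for J'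
      using that psubset.prems by (intro psubset.IH) auto
  qed
qed

lemma linear_operator_H_PD:
  assumes "J \<subseteq> D"
  shows "linear_operator J (H_PD J)"
  using assms
proof (induction J rule: subset_induct_D)
  case (psubset J)
  note L = linear_operator_partial_expectation[OF psubset.hyps]
  have LD: "L_PD J g \<in> V D" if "g \<in> V D" for g
    using L_PD_in_V_D[OF psubset.hyps that] .
  have H: "linear_operator J' (H_PD J')" if "J' \<subset> J" for J'
    using psubset.IH[OF that] .
  have "H_PD J g \<in> V J" if "g \<in> V D" for g
    unfolding H_PD_eq[OF psubset.hyps]
    using linear_operator_in[OF L that] linear_operator_in[OF H LD[OF that]] V_mono
    by (intro V_diff_sum) blast+
  moreover have "H_PD J (\<lambda>x\<in>\<Omega>. f x + g x) = (\<lambda>x\<in>\<Omega>. H_PD J f x + H_PD J g x)"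
    if "f \<in> V D" "g \<in> V D" for f g
    unfolding H_PD_eq[OF psubset.hyps] linear_operator_add[OF L that]
    using linear_operator_add[OF H LD[OF that(1)] LD[OF that(2)]]
    by (auto simp: fun_eq_iff sum.distrib)
  moreover have "H_PD J (\<lambda>x\<in>\<Omega>. c * f x) = (\<lambda>x\<in>\<Omega>. c * H_PD J f x)"
    if "f \<in> V D" for c f
    unfolding H_PD_eq[OF psubset.hyps] linear_operator_scale[OF L that]
    using linear_operator_scale[OF H LD[OF that]]
    by (auto simp: fun_eq_iff sum_distrib_left right_diff_distrib)
  ultimately show ?case
    by (auto simp: linear_operator_def)
qed

lemmas H_PD_in_V = linear_operator_in[OF linear_operator_H_PD]

lemma H_PD_in_V_D: "J \<subseteq> D \<Longrightarrow> g \<in> V D \<Longrightarrow> H_PD J g \<in> V D"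
  using H_PD_in_V V_mono by blast

lemma H_PD_zero: "J \<subseteq> D \<Longrightarrow> H_PD J (\<lambda>x\<in>\<Omega>. 0) = (\<lambda>x\<in>\<Omega>. 0)"
  by (rule linear_operator_zero[OF linear_operator_H_PD])

lemma H_PD_extensional: "J \<subseteq> D \<Longrightarrow> g \<in> V D \<Longrightarrow> H_PD J g \<in> extensional \<Omega>"
  by (rule V_extensional[OF H_PD_in_V])

lemma Pow_eq_insert_psubset: "Pow J = insert J {J'. J' \<subset> J}"
  by auto

lemma finite_psubsets: "J \<subseteq> D \<Longrightarrow> finite {J'. J' \<subset> J}"
  using finite_subset_D[of J] by (auto intro: finite_subset[of _ "Pow J"])

text \<open>As \<open>L_PD J\<close> fixes \<open>g\<close>, the recursion makes the summand for
  \<open>J\<close> equal to \<open>g\<close> minus the summands for its proper subsets.\<close>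

lemma sum_H_PD:
  assumes "J \<subseteq> D" "g \<in> V J"
  shows "(\<lambda>x\<in>\<Omega>. \<Sum>J'\<in>Pow J. H_PD J' g x) = g"
proof -
  have "(\<lambda>x\<in>\<Omega>. \<Sum>J'\<in>Pow J. H_PD J' g x) = (\<lambda>x\<in>\<Omega>. g x)"
    by (auto simp: fun_eq_iff Pow_eq_insert_psubset finite_psubsets assms(1)
        H_PD_eq[OF assms(1)] partial_expectation_id[OF assms(2)])
  then show ?thesis
    by (simp add: V_restrict_id[OF assms(2)])
qed

lemma lean_decomposable_H_PD: "lean_decomposable H_PD"
  by (simp add: lean_decomposable_def sum_H_PD)

text \<open>
  The partial expectation of \<open>g\<close> inherits the independence of \<open>x\<^sub>j\<close>. So it is recovered by
  summing over \<open>J' \<subseteq> J - {j}\<close> only, and by induction the remaining terms vanish.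
\<close>

lemma H_PD_eq_zero:
  assumes "J \<subseteq> D" "j \<in> J" "g \<in> V (D - {j})"
  shows "H_PD J g = (\<lambda>x\<in>\<Omega>. 0)"
  using assms
proof (induction J arbitrary: g rule: subset_induct_D)
  case (psubset J)
  define f where "f = L_PD J g"
  have f: "f \<in> V (J - {j})"
    unfolding f_def using psubset.hyps
    by (intro V_mono[OF partial_expectation_in_V[OF psubset.hyps psubset.prems(2)]]) auto
  \<comment> \<open>The induction hypothesis will be applied to \<open>f\<close> in place of
    \<open>g\<close>, which is why the induction generalizes over the function.\<close>
  have fD: "f \<in> V (D - {j})"
    using f psubset.hyps by (auto intro: V_mono)
  have "(\<Sum>J' | J' \<subset> J. H_PD J' f x) = f x" if x: "x \<in> \<Omega>" for x
  proof -
    have "(\<Sum>J' | J' \<subset> J. H_PD J' f x) = (\<Sum>J'\<in>Pow (J - {j}). H_PD J' f x)"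
    proof (rule sum.mono_neutral_right)
      show "finite {J'. J' \<subset> J}" using finite_psubsets[OF psubset.hyps] .
      show "Pow (J - {j}) \<subseteq> {J'. J' \<subset> J}" using psubset.prems(1) by auto
      show "\<forall>J'\<in>{J'. J' \<subset> J} - Pow (J - {j}). H_PD J' f x = 0"
      proof
        fix J' assume "J' \<in> {J'. J' \<subset> J} - Pow (J - {j})"
        then have "H_PD J' f = (\<lambda>x\<in>\<Omega>. 0)"
          by (intro psubset.IH[OF _ _ fD]) auto
        with x show "H_PD J' f x = 0" by simp
      qed
    qed
    also have "\<dots> = f x"
      using fun_cong[OF sum_H_PD[OF _ f], of x] psubset.hyps x by auto
    finally show ?thesis .
  qed
  then show ?case
    by (simp add: H_PD_eq[OF psubset.hyps] flip: f_def cong: restrict_cong)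
qed

section \<open>Relevance, by means of the alternating sum\<close>

text \<open>In the alternating sum the term for \<open>K = {}\<close> is \<open>g\<close>; every
  other term is constant in some coordinate of \<open>J\<close> and is annihilated by
  \<open>H_PD_eq_zero\<close>. Applying the linear \<open>H_PD J\<close> to the vanishing sum
  therefore leaves only \<open>H_PD J g\<close>.\<close>

lemma relevant_H_PD: "relevant H_PD"
  unfolding relevant_def
proof (intro allI ballI impI)
  fix J g assume J: "J \<subseteq> D" and g: "g \<in> V D" and pv: "partial_vanishes J g"
  \<comment> \<open>One anchor point is enough; a realized value of the feature vector serves, as
    the sample space of a probability measure is nonempty.\<close>
  obtain a where a: "a \<in> \<Omega>"
    using X_in_\<Omega> not_empty by blast
  define s where "s K = (\<lambda>x\<in>\<Omega>. g (override_on x a K))" for K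
  \<comment> \<open>The anchors in \<open>partial_vanishes\<close> are tuples indexed by
    \<open>J\<close> alone, so \<open>a\<close> is cut down to \<open>J\<close>; overrides on
    subsets of \<open>J\<close> do not notice.\<close>
  have aJ: "(\<lambda>j\<in>J. a j) \<in> (\<Pi>\<^sub>E j\<in>J. \<X> j)"
    using a J by (auto simp: \<Omega>_def)
  have s: "s K \<in> V (D - K)" for K
    unfolding s_def using V_section[OF g a] .
  have sD: "s K \<in> V D" for K
    using s by (rule V_mono) auto
  have "(\<Sum>K\<in>Pow J. (-1) ^ card K * s K x) = 0" if x: "x \<in> \<Omega>" for x
  proof -
    have "(\<Sum>K\<in>Pow J. (-1) ^ card K * s K x)
        = (\<Sum>K\<in>Pow J. (-1) ^ card K * g (override_on x (\<lambda>j\<in>J. a j) K))"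
    proof (rule sum.cong[OF refl])
      fix K assume "K \<in> Pow J"
      then have "override_on x (\<lambda>j\<in>J. a j) K = override_on x a K"
        by (auto simp: override_on_def fun_eq_iff)
      with x show "(-1) ^ card K * s K x = (-1) ^ card K * g (override_on x (\<lambda>j\<in>J. a j) K)"
        by (simp add: s_def)
    qed
    then show ?thesis
      using pv aJ x by (simp add: partial_vanishes_def)
  qed
  then have "H_PD J (\<lambda>x\<in>\<Omega>. \<Sum>K\<in>Pow J. (-1) ^ card K * s K x) = (\<lambda>x\<in>\<Omega>. 0)"
    using H_PD_zero[OF J] by (simp cong: restrict_cong)
  then have z: "(\<lambda>x\<in>\<Omega>. \<Sum>K\<in>Pow J. (-1) ^ card K * H_PD J (s K) x) = (\<lambda>x\<in>\<Omega>. 0)"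
    by (simp add: linear_operator_sum[OF linear_operator_H_PD[OF J] sD])
  have nz: "H_PD J (s K) = (\<lambda>x\<in>\<Omega>. 0)" if K: "K \<in> Pow J - {{}}" for K
  proof -
    obtain j where "j \<in> K" using K by blast
    with K show ?thesis
      using V_mono[OF s, of K "D - {j}"] by (intro H_PD_eq_zero[OF J, of j]) auto
  qed
  have "s {} = g"
    using V_restrict_id[OF g] by (simp add: s_def)
  have "H_PD J g x = 0" if x: "x \<in> \<Omega>" for x
  proof -
    have "0 = (\<Sum>K\<in>Pow J. (-1) ^ card K * H_PD J (s K) x)"
      using fun_cong[OF z, of x] x by simp
    also have "\<dots> = (\<Sum>K\<in>{{}}. (-1) ^ card K * H_PD J (s K) x)"
      using nz x finite_subset_D[OF J] by (intro sum.mono_neutral_right) auto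
    also have "\<dots> = H_PD J g x"
      by (simp add: \<open>s {} = g\<close>)
    finally show ?thesis ..
  qed
  then show "H_PD J g = (\<lambda>x\<in>\<Omega>. 0)"
    using H_PD_extensional[OF J g] by (auto simp: fun_eq_iff extensional_def)
qed

section \<open>Compositions of components: idempotence, orthogonality and unbiasedness\<close>

text \<open>A coordinate \<open>j\<close> in \<open>J'\<close> but not in \<open>J\<close> is one on
  which \<open>H_PD J g\<close> does not depend, so \<open>H_PD_eq_zero\<close> applies.\<close>

lemma H_PD_comp_not_subset:
  assumes "J \<subseteq> D" "J' \<subseteq> D" "\<not> J' \<subseteq> J" "g \<in> V D"
  shows "H_PD J' (H_PD J g) = (\<lambda>x\<in>\<Omega>. 0)"
proof -
  obtain j where j: "j \<in> J'" "j \<notin> J" using assms(3) by blast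
  then have "H_PD J g \<in> V (D - {j})"
    using H_PD_in_V[OF assms(1,4)] assms(1) by (auto intro: V_mono)
  with j show ?thesis
    using H_PD_eq_zero[OF assms(2)] by blast
qed

text \<open>Idempotence and orthogonality are proved jointly because the induction uses both: once
  \<open>H_PD J g\<close> is expanded by the recursion, compositions with smaller components
  \<open>K\<close> vanish for \<open>K \<noteq> J'\<close> and reproduce \<open>H_PD J' f\<close>
  for \<open>K = J'\<close>.\<close>

lemma H_PD_comp:
  assumes "J \<subseteq> D" "J' \<subseteq> D" "g \<in> V D"
  shows "H_PD J' (H_PD J g) = (if J' = J then H_PD J g else (\<lambda>x\<in>\<Omega>. 0))"
  using assms
proof (induction J arbitrary: J' g rule: subset_induct_D)
  case (psubset J)
  define f where "f = L_PD J g"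
  have f: "f \<in> V J"
    unfolding f_def
    using linear_operator_in[OF linear_operator_partial_expectation[OF psubset.hyps] psubset.prems(2)] .
  then have fD: "f \<in> V D" using psubset.hyps by (rule V_mono)
  have Hg: "H_PD J g = (\<lambda>x\<in>\<Omega>. f x - (\<Sum>K | K \<subset> J. H_PD K f x))"
    unfolding f_def by (rule H_PD_eq[OF psubset.hyps])
  \<comment> \<open>The recursion sees its argument only through \<open>L_PD J\<close>, which fixes
    \<open>f\<close>.\<close>
  have Hf: "H_PD J f = H_PD J g"
    unfolding Hg H_PD_eq[OF psubset.hyps, of f] partial_expectation_id[OF f] ..
  have sub: "K \<subseteq> D" if "K \<subset> J" for K using that psubset.hyps by blast
  have expand: "H_PD J' (H_PD J g) = (\<lambda>x\<in>\<Omega>. H_PD J' f x - (\<Sum>K | K \<subset> J. H_PD J' (H_PD K f) x))"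
    unfolding Hg using sub
    by (intro linear_operator_diff_sum[OF linear_operator_H_PD[OF psubset.prems(1)]] fD
        H_PD_in_V_D) auto
  consider "\<not> J' \<subseteq> J" | "J' = J" | "J' \<subset> J" by blast
  then show ?case
  proof cases
    case 1
    then show ?thesis
      using H_PD_comp_not_subset[OF psubset.hyps psubset.prems(1) _ psubset.prems(2)] by auto
  next
    case 2
    \<comment> \<open>A proper subset \<open>K\<close> does not contain \<open>J\<close>, so these
      terms vanish without the induction hypothesis.\<close>
    have "H_PD J (H_PD K f) = (\<lambda>x\<in>\<Omega>. 0)" if "K \<subset> J" for K
      using that by (intro H_PD_comp_not_subset[OF sub psubset.hyps _ fD]) auto
    then have "H_PD J (H_PD J g) = (\<lambda>x\<in>\<Omega>. H_PD J f x)"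
      using expand 2 by (simp cong: restrict_cong)
    also have "\<dots> = H_PD J g"
      unfolding Hf by (rule V_restrict_id[OF H_PD_in_V[OF psubset.hyps psubset.prems(2)]])
    finally show ?thesis using 2 by simp
  next
    case 3
    \<comment> \<open>By the induction hypothesis only \<open>K = J'\<close> survives, and it
      cancels the leading term \<open>H_PD J' f\<close>.\<close>
    have "(\<Sum>K | K \<subset> J. H_PD J' (H_PD K f) x) = H_PD J' f x" if x: "x \<in> \<Omega>" for x
    proof -
      have "(\<Sum>K | K \<subset> J. H_PD J' (H_PD K f) x) = (\<Sum>K | K \<subset> J. if K = J' then H_PD J' f x else 0)"
        using x by (intro sum.cong[OF refl]) (auto simp: psubset.IH[OF _ psubset.prems(1) fD])
      then show ?thesis
        using 3 by (simp add: finite_psubsets[OF psubset.hyps])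
    qed
    with 3 show ?thesis
      using expand by (auto cong: restrict_cong)
  qed
qed

text \<open>The full expectation is the component of the empty set, so this is orthogonality with
  \<open>J' = {}\<close>.\<close>

lemma unbiased_H_PD: "unbiased H_PD"
  unfolding unbiased_def using H_PD_comp[of _ "{}"] by (auto simp: H_PD_empty)

lemma consistent_with_PD_H_PD: "consistent_with_PD H_PD"
  unfolding consistent_with_PD_def
proof (intro impI allI ballI)
  fix J g
  assume indep: "indep_vars (\<lambda>_. borel) X D" and J: "J \<subseteq> D" and g: "g \<in> V D"
  \<comment> \<open>\<open>H_PD J'\<close> depends on its argument only through
    \<open>L_PD J'\<close>, which absorbs a preceding \<open>L_PD J\<close> under
    independence.\<close>
  have "H_PD J' (L_PD J g) = H_PD J' g" if "J' \<subset> J" for J'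
    using that J by (simp add: H_PD_eq[of J'] partial_expectation_comp_indep[OF indep _ J g])
  then have "(\<lambda>x\<in>\<Omega>. \<Sum>J'\<in>Pow J. H_PD J' g x) = (\<lambda>x\<in>\<Omega>. L_PD J g x)"
    by (auto simp: fun_eq_iff Pow_eq_insert_psubset finite_psubsets J H_PD_eq[OF J])
  then show "(\<lambda>x\<in>\<Omega>. \<Sum>J'\<in>Pow J. H_PD J' g x) = partial_expectation J g"
    using V_restrict_id[OF L_PD_in_V_D[OF J g]] by simp
qed

lemma interaction_decomposition_H_PD: "interaction_decomposition H_PD"
  unfolding interaction_decomposition_def
  using linear_operator_H_PD unbiased_H_PD relevant_H_PD lean_decomposable_H_PD
    consistent_with_PD_H_PD
  by (auto simp: idempotent_def operationally_orthogonal_def H_PD_comp)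

end

theorem proposition7:
  fixes M :: "'a measure" and d :: nat
    and \<X> :: "nat \<Rightarrow> real set" and X :: "nat \<Rightarrow> 'a \<Rightarrow> real"
  assumes "feature_model M d \<X> X"
  shows "feature_model.interaction_decomposition M d \<X> X (feature_model.H_PD M d \<X> X)"
  using assms by (rule feature_model.interaction_decomposition_H_PD)

end
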